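(* For every positive integer $n$, $$N_2(n)=2\sum_{r=0}^{n-2}(2r+1)\,\overline{p}_{3,r+2}(n),\qquad M_2(n)=2\sum_{r=0}^{n-1}(2r+1)\,\overline{p}_{1,r+1}(n).$$
   Context: A partition of $n$ is a finite multiset of positive integers summing to $n$. The rank of a partition is its largest part minus its number of parts; $N(m,n)$ is the number of partitions of $n$ with rank $m$. The crank of a partition is its largest part if $1$ is not a part, and otherwise (the number of parts larger than the number of ones) minus (the number of ones); $M(m,n)$ is the number of partitions of $n$ with crank $m$, with the standard convention $M(-1,1)=M(1,1)=1$, $M(0,1)=-1$, $M(m,1)=0$ otherwise. The second rank and crank moments are $N_2(n)=\sum_{m\in\mathbb Z}m^2N(m,n)$ and $M_2(n)=\sum_{m\in\mathbb Z}m^2M(m,n)$. For positive integers $A,a$ and a partition $\pi$, $\mathrm{mex}_{A,a}(\pi)$ is the smallest element of $\{a,a+A,a+2A,\dots\}$ that is not a part of $\pi$; $\overline{p}_{A,a}(n)$ is the number of partitions $\pi$ of $n$ with $\mathrm{mex}_{A,a}(\pi)\equiv A+a \pmod{2A}$. *)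

theory Defs
  imports Main "HOL-Library.Multiset" "HOL-Library.Groups_Big_Fun" "HOL-Number_Theory.Cong"
begin

definition partitions :: "nat \<Rightarrow> nat multiset set" where
  "partitions n = {\<pi>. 0 \<notin># \<pi> \<and> sum_mset \<pi> = n}"

text \<open>The inserted \<open>0\<close> only matters for the empty partition, whose largest part is taken to be \<open>0\<close>.\<close>

definition largest_part :: "nat multiset \<Rightarrow> nat" where
  "largest_part \<pi> = Max (insert 0 (set_mset \<pi>))"

definition rank :: "nat multiset \<Rightarrow> int" where
  "rank \<pi> = int (largest_part \<pi>) - int (size \<pi>)"

definition rank_count :: "int \<Rightarrow> nat \<Rightarrow> nat" where
  "rank_count m n = card {\<pi> \<in> partitions n. rank \<pi> = m}"

definition crank :: "nat multiset \<Rightarrow> int" where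
  "crank \<pi> =
     (if 1 \<notin># \<pi> then int (largest_part \<pi>)
      else int (size {#x \<in># \<pi>. x > count \<pi> 1#}) - int (count \<pi> 1))"

text \<open>For \<open>n = 1\<close> the values are the conventional ones (the coefficients of the crank
  generating function), not a count of partitions; in particular \<open>M(0,1) = -1\<close>, so
  the values are integers.\<close>

definition crank_count :: "int \<Rightarrow> nat \<Rightarrow> int" where
  "crank_count m n =
     (if n = 1 then (if m = 1 \<or> m = - 1 then 1 else if m = 0 then - 1 else 0)
      else int (card {\<pi> \<in> partitions n. crank \<pi> = m}))"

text \<open>For fixed \<open>n\<close> only finitely many \<open>m\<close> contribute to the moments, so
  \<^const>\<open>Sum_any\<close> is the sum over all integers \<open>m\<close>.\<close>

definition rank_moment2 :: "nat \<Rightarrow> int" where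
  "rank_moment2 n = Sum_any (\<lambda>m::int. m\<^sup>2 * int (rank_count m n))"

definition crank_moment2 :: "nat \<Rightarrow> int" where
  "crank_moment2 n = Sum_any (\<lambda>m::int. m\<^sup>2 * crank_count m n)"

definition mex :: "nat \<Rightarrow> nat \<Rightarrow> nat multiset \<Rightarrow> nat" where
  "mex A a \<pi> = (LEAST x. (\<exists>k. x = a + k * A) \<and> x \<notin># \<pi>)"

definition pbar :: "nat \<Rightarrow> nat \<Rightarrow> nat \<Rightarrow> nat" where
  "pbar A a n = card {\<pi> \<in> partitions n. [mex A a \<pi> = A + a] (mod (2 * A))}"

end

theory Submission
  imports Defs
begin

text \<open>
  Since \<open>x\<^sup>2\<close> is the sum of \<open>2 r + 1\<close> over \<open>r < \<bar>x\<bar>\<close>, both identities follow from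
  \<open>#{rank \<ge> j} = #{rank \<le> -j} = \<close>\<^term>\<open>pbar 3 (j + 1) n\<close> and
  \<open>#{crank \<ge> j} = #{crank \<le> -j} = \<close>\<^term>\<open>pbar 1 j n\<close> for \<open>j \<ge> 1\<close> (the last one if \<open>n \<noteq> 1\<close>). Deleting one part \<open>a\<close> gives
  \<open>pbar A a (n + a) + pbar A (a + A) n = p(n)\<close>, which determines \<open>pbar\<close>, so it is enough to verify
  the same recurrence on the other side. For the rank it is Dyson's map: delete the first column and
  insert a new largest part. For the crank, let \<open>f k\<close> be the number of parts larger than \<open>k\<close> and
  \<open>\<omega>\<close> the number of ones; for fixed \<open>\<omega> \<ge> 1\<close> and \<open>k, v \<ge> 1\<close> the conditions \<open>f k > v\<close> and \<open>f v > k\<close>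
  are equinumerous (conjugate after deleting ones), so \<open>crank \<ge> i + 1\<close> may be replaced by
  \<open>f (\<omega> + i) > \<omega>\<close>; this count satisfies the recurrence by moving a row at the corner of the
  Durfee rectangle of excess \<open>i\<close> into ones. The case \<open>crank \<le> -j\<close> reduces to the
  complement of the same condition after deleting \<open>j\<close> ones.
\<close>

subsection \<open>Ferrers diagrams as column functions\<close>

text \<open>The value \<open>f k\<close> stands for the number of parts larger than
  \<open>k\<close>, so \<open>f 0\<close> is the number of parts. This is the statistic in the
  crank, and adding or deleting ones changes only \<open>f 0\<close>.\<close>

definition ferrers :: "nat \<Rightarrow> (nat \<Rightarrow> nat) set" where
  "ferrers n = {f. antimono f \<and> (\<exists>K. (\<forall>k\<ge>K. f k = 0) \<and> sum f {..<K} = n)}"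

lemma ferrersI:
  assumes "\<And>k. f (Suc k) \<le> f k" "\<And>k. k \<ge> K \<Longrightarrow> f k = 0" "sum f {..<K} = n"
  shows "f \<in> ferrers n"
  using assms unfolding ferrers_def antimono_iff_le_Suc by blast

lemma ferrers_antimono: "f \<in> ferrers n \<Longrightarrow> i \<le> j \<Longrightarrow> f j \<le> f i"
  by (auto simp: ferrers_def antimono_def)

lemma sum_support_le:
  fixes f :: "nat \<Rightarrow> nat"
  assumes "\<forall>k\<ge>K. f k = 0" "K \<le> L"
  shows "sum f {..<L} = sum f {..<K}"
  using assms by (intro sum.mono_neutral_right) auto

lemma ferrers_sum:
  assumes "f \<in> ferrers n" "\<And>k. k \<ge> K \<Longrightarrow> f k = 0"
  shows "sum f {..<K} = n"
proof -
  obtain L where L: "\<forall>k\<ge>L. f k = 0" "sum f {..<L} = n"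
    using assms(1) by (auto simp: ferrers_def)
  show ?thesis
    using sum_support_le[of K f L] sum_support_le[of L f K] assms(2) L by (cases "K \<le> L") auto
qed

text \<open>Otherwise the first \<open>k + 1\<close> columns are nonempty and contain more than
  \<open>n\<close> cells. So \<open>n\<close> serves as a uniform cut-off for sums over
  columns.\<close>

lemma ferrers_eq_0:
  assumes f: "f \<in> ferrers n" and "n \<le> k"
  shows "f k = 0"
proof (rule ccontr)
  assume nz: "f k \<noteq> 0"
  obtain K where K: "\<forall>k\<ge>K. f k = 0" "sum f {..<K} = n"
    using f by (auto simp: ferrers_def)
  have "k < K" using K nz by (meson not_less)
  have "Suc k = (\<Sum>i<Suc k. 1)" by simp
  also have "\<dots> \<le> sum f {..<Suc k}"
    using nz ferrers_antimono[OF f] by (intro sum_mono) (metis One_nat_def Suc_leI lessThan_iff less_Suc_eq_le neq0_conv order_less_le_trans)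
  also have "\<dots> \<le> sum f {..<K}" using \<open>k < K\<close> by (intro sum_mono2) auto
  finally show False using K assms by simp
qed

lemma ferrers_sum_self: "f \<in> ferrers n \<Longrightarrow> sum f {..<n} = n"
  using ferrers_sum ferrers_eq_0 by blast

lemma ferrers_le:
  assumes "f \<in> ferrers n"
  shows "f k \<le> n"
proof (cases "k < n")
  case True
  then have "f k \<le> sum f {..<n}" by (intro member_le_sum) auto
  then show ?thesis using ferrers_sum_self[OF assms] by simp
qed (use ferrers_eq_0[OF assms, of k] in simp)

lemma finite_ferrers [simp]: "finite (ferrers n)"
proof (rule finite_subset)
  show "ferrers n \<subseteq> {f. \<forall>k. (k \<in> {..<n} \<longrightarrow> f k \<in> {..n}) \<and> (k \<notin> {..<n} \<longrightarrow> f k = 0)}"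
    using ferrers_le ferrers_eq_0 by auto
qed (rule finite_set_of_finite_funs, auto)

text \<open>The size recovers column \<open>0\<close> from the others. This settles injectivity for
  a map that alters the number of ones.\<close>

lemma ferrers_eqI:
  assumes f: "f \<in> ferrers n" and g: "g \<in> ferrers n" and eq: "\<And>k. k \<ge> 1 \<Longrightarrow> f k = g k"
  shows "f = g"
proof -
  have s: "h 0 + (\<Sum>k\<in>{1..n}. h k) = n" if "h \<in> ferrers n" for h
  proof -
    have "sum h {..<Suc n} = n" using that ferrers_eq_0[OF that] by (intro ferrers_sum) auto
    moreover have "{..<Suc n} = insert 0 {1..n}" by auto
    ultimately show ?thesis by simp
  qed
  have "(\<Sum>k\<in>{1..n}. f k) = (\<Sum>k\<in>{1..n}. g k)" using eq by (intro sum.cong) auto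
  then have "f 0 = g 0" using s[OF f] s[OF g] by linarith
  then show ?thesis using eq by (metis One_nat_def Suc_leI ext neq0_conv)
qed

section \<open>Conjugation of diagrams\<close>

definition conjugate :: "(nat \<Rightarrow> nat) \<Rightarrow> nat \<Rightarrow> nat" where
  "conjugate f k = card {e. k < f e}"

text \<open>Monotonicity makes the columns longer than \<open>k\<close> an initial segment; both
  sides then say that the cell in row \<open>k\<close> and column \<open>e\<close> lies in the
  diagram.\<close>

lemma less_conjugate_iff:
  assumes f: "f \<in> ferrers n"
  shows "e < conjugate f k \<longleftrightarrow> k < f e"
proof -
  define c where "c = (LEAST e. f e \<le> k)"
  have "f n \<le> k" using ferrers_eq_0[OF f] by simp
  then have c: "f c \<le> k" unfolding c_def by (rule LeastI)
  have iff: "k < f e \<longleftrightarrow> e < c" for e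
    using c ferrers_antimono[OF f, of c e] not_less_Least[of e "\<lambda>e. f e \<le> k"]
    unfolding c_def[symmetric] by (meson le_less_trans not_less)
  then have "{e. k < f e} = {..<c}" by auto
  then show ?thesis using iff by (simp add: conjugate_def)
qed

lemma conjugate_eqI: "(\<And>e. e < m \<longleftrightarrow> k < f e) \<Longrightarrow> conjugate f k = m"
proof -
  assume "\<And>e. e < m \<longleftrightarrow> k < f e"
  then have "{e. k < f e} = {..<m}" by auto
  then show ?thesis by (simp add: conjugate_def)
qed

lemma conjugate_conjugate: "f \<in> ferrers n \<Longrightarrow> conjugate (conjugate f) = f"
  by (intro ext conjugate_eqI) (simp add: less_conjugate_iff)

text \<open>The size is preserved because the cells are counted once by rows and once by
  columns.\<close>

lemma conjugate_ferrers:
  assumes f: "f \<in> ferrers n"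
  shows "conjugate f \<in> ferrers n"
proof (rule ferrersI)
  fix k
  show "conjugate f (Suc k) \<le> conjugate f k"
    by (metis f less_conjugate_iff linorder_not_less Suc_lessD order_less_irrefl)
next
  fix k assume "k \<ge> n"
  then show "conjugate f k = 0"
    using less_conjugate_iff[OF f, of 0 k] ferrers_le[OF f, of 0] by simp
next
  have "(\<Sum>k<n. conjugate f k) = (\<Sum>k<n. \<Sum>e<n. if k < f e then 1 else 0)"
  proof (intro sum.cong refl)
    fix k
    have "{e. k < f e} = {e \<in> {..<n}. k < f e}" using ferrers_eq_0[OF f] by (metis (mono_tags, lifting) Collect_cong lessThan_iff linorder_not_less not_less_zero)
    then show "conjugate f k = (\<Sum>e<n. if k < f e then 1 else 0)"
      by (simp add: conjugate_def sum.If_cases Int_def)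
  qed
  also have "\<dots> = (\<Sum>e<n. \<Sum>k<n. if k < f e then 1 else 0)" by (rule sum.swap)
  also have "\<dots> = (\<Sum>e<n. f e)"
  proof (intro sum.cong refl)
    fix e
    have "{k \<in> {..<n}. k < f e} = {..<f e}" using ferrers_le[OF f, of e] by auto
    then show "(\<Sum>k<n. if k < f e then 1 else 0) = f e" by (simp add: sum.If_cases Int_def)
  qed
  finally show "sum (conjugate f) {..<n} = n" using ferrers_sum_self[OF f] by simp
qed

lemma card_ferrers_conjugate:
  "card {f \<in> ferrers n. Q (conjugate f)} = card {f \<in> ferrers n. Q f}"
  by (rule bij_betw_same_card[of conjugate], rule bij_betw_byWitness[where f' = conjugate])
     (auto simp: conjugate_conjugate conjugate_ferrers)

lemma card_filter_not:
  assumes "finite A"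
  shows "card {x \<in> A. \<not> Q x} + card {x \<in> A. Q x} = card A"
proof -
  have "card ({x \<in> A. \<not> Q x} \<union> {x \<in> A. Q x}) = card {x \<in> A. \<not> Q x} + card {x \<in> A. Q x}"
    using assms by (intro card_Un_disjoint) auto
  moreover have "{x \<in> A. \<not> Q x} \<union> {x \<in> A. Q x} = A" by auto
  ultimately show ?thesis by simp
qed

subsection \<open>Partitions and their column functions\<close>

definition cols :: "nat multiset \<Rightarrow> nat \<Rightarrow> nat" where
  "cols \<pi> k = size {#x \<in># \<pi>. k < x#}"

lemma cols_add_mset: "cols (add_mset x \<pi>) k = (if k < x then 1 else 0) + cols \<pi> k"
  by (simp add: cols_def)

lemma cols_Suc: "cols \<pi> k = count \<pi> (Suc k) + cols \<pi> (Suc k)"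
  by (induction \<pi>) (auto simp: cols_add_mset, auto simp: cols_def)

lemma cols_pos_iff: "0 < cols \<pi> k \<longleftrightarrow> (\<exists>x\<in>#\<pi>. k < x)"
  by (induction \<pi>) (auto simp: cols_add_mset, simp add: cols_def)

lemma sum_cols: "(\<And>x. x \<in># \<pi> \<Longrightarrow> x \<le> K) \<Longrightarrow> sum (cols \<pi>) {..<K} = sum_mset \<pi>"
proof (induction \<pi>)
  case (add x \<pi>)
  have "{k \<in> {..<K}. k < x} = {..<x}" using add.prems[of x] by auto
  then show ?case using add by (simp add: cols_add_mset sum.distrib sum.If_cases Int_def)
qed (simp add: cols_def)

lemma cols_ferrers: "cols \<pi> \<in> ferrers (sum_mset \<pi>)"
proof (rule ferrersI)
  have le: "x \<le> sum_mset \<pi>" if "x \<in># \<pi>" for x using that by (simp add: sum_mset.remove)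
  show "sum (cols \<pi>) {..<sum_mset \<pi>} = sum_mset \<pi>" using le by (rule sum_cols)
  show "cols \<pi> k = 0" if "k \<ge> sum_mset \<pi>" for k using le that by (metis cols_pos_iff bot_nat_0.not_eq_extremum linorder_not_less order_trans)
qed (metis cols_Suc le_add2)

text \<open>Injectivity: differences of consecutive columns are the multiplicities of the parts, by
  \<open>cols_Suc\<close>.\<close>

lemma bij_betw_cols: "bij_betw cols (partitions n) (ferrers n)"
proof (rule bij_betw_imageI)
  show "inj_on cols (partitions n)"
  proof (rule inj_onI, rule multiset_eqI)
    fix \<pi> \<rho> x assume *: "\<pi> \<in> partitions n" "\<rho> \<in> partitions n" "cols \<pi> = cols \<rho>"
    show "count \<pi> x = count \<rho> x"
    proof (cases x)
      case 0
      then show ?thesis using * by (simp add: partitions_def count_eq_zero_iff[symmetric] del: count_eq_zero_iff)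
    next
      case (Suc k)
      then show ?thesis using cols_Suc[of \<pi> k] cols_Suc[of \<rho> k] * by simp
    qed
  qed
  show "cols ` partitions n = ferrers n"
  proof
    show "cols ` partitions n \<subseteq> ferrers n" using cols_ferrers by (auto simp: partitions_def)
    show "ferrers n \<subseteq> cols ` partitions n"
    proof
      fix f assume f: "f \<in> ferrers n"
      \<comment> \<open>The parts of the preimage are the nonzero row lengths of the
        diagram.\<close>
      define \<pi> where "\<pi> = {#x \<in># image_mset (conjugate f) (mset_set {..<n}). x > 0#}"
      have "sum_mset {#x \<in># M. x > 0#} = sum_mset M" for M :: "nat multiset"
        by (induction M) auto
      then have "sum_mset \<pi> = sum_mset (image_mset (conjugate f) (mset_set {..<n}))"
        by (simp add: \<pi>_def)
      also have "\<dots> = n"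
        using ferrers_sum_self[OF conjugate_ferrers[OF f]] by (simp add: sum_unfold_sum_mset)
      finally have "\<pi> \<in> partitions n" by (simp add: partitions_def \<pi>_def)
      moreover have "cols \<pi> = f"
      proof
        fix k
        have "{e. e < n \<and> k < conjugate f e} = {e. k < conjugate f e}"
          using ferrers_eq_0[OF conjugate_ferrers[OF f]] by (metis linorder_not_less not_less_zero)
        moreover have "{#x \<in># \<pi>. k < x#} = image_mset (conjugate f) {#e \<in># mset_set {..<n}. k < conjugate f e#}"
          unfolding \<pi>_def filter_filter_mset filter_mset_image_mset
          by (intro arg_cong[where f = "image_mset _"] filter_mset_cong) auto
        ultimately have "cols \<pi> k = conjugate (conjugate f) k"
          by (simp add: cols_def conjugate_def[of "conjugate f"])
        then show "cols \<pi> k = f k" using conjugate_conjugate[OF f] by simp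
      qed
      ultimately show "f \<in> cols ` partitions n" by blast
    qed
  qed
qed

lemma card_partitions_cols:
  "card {\<pi> \<in> partitions n. Q (cols \<pi>)} = card {f \<in> ferrers n. Q f}"
proof (rule bij_betw_same_card[of cols])
  show "bij_betw cols {\<pi> \<in> partitions n. Q (cols \<pi>)} {f \<in> ferrers n. Q f}"
    using bij_betw_cols[of n] unfolding bij_betw_def inj_on_def by blast
qed

lemma finite_partitions [simp]: "finite (partitions n)"
  using bij_betw_finite[OF bij_betw_cols] by simp

lemma card_partitions: "card (partitions n) = card (ferrers n)"
  using bij_betw_same_card[OF bij_betw_cols] .

lemma cols_0: "0 \<notin># \<pi> \<Longrightarrow> cols \<pi> 0 = size \<pi>"
  unfolding cols_def by (metis bot_nat_0.not_eq_extremum filter_mset_True filter_mset_cong)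

lemma less_largest_part_iff: "k < largest_part \<pi> \<longleftrightarrow> 0 < cols \<pi> k"
  by (auto simp: largest_part_def cols_pos_iff Max_gr_iff)

lemma largest_part_eq_conjugate: "largest_part \<pi> = conjugate (cols \<pi>) 0"
  by (rule sym, rule conjugate_eqI) (rule less_largest_part_iff)

subsection \<open>The mex recurrence\<close>

definition run_length :: "nat \<Rightarrow> nat \<Rightarrow> nat multiset \<Rightarrow> nat" where
  "run_length A a \<pi> = (LEAST k. a + k * A \<notin># \<pi>)"

lemma run_length_eqI:
  "a + k * A \<notin># \<pi> \<Longrightarrow> (\<And>i. i < k \<Longrightarrow> a + i * A \<in># \<pi>) \<Longrightarrow> run_length A a \<pi> = k"
  unfolding run_length_def by (rule Least_equality) (use not_less in blast)+

lemma run_length_props: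
  assumes A: "A \<ge> 1"
  shows "a + run_length A a \<pi> * A \<notin># \<pi>" "i < run_length A a \<pi> \<Longrightarrow> a + i * A \<in># \<pi>"
proof -
  have "\<exists>k. a + k * A \<notin># \<pi>"
  proof (rule ccontr)
    assume "\<not> ?thesis"
    then have "range (\<lambda>k. a + k * A) \<subseteq> set_mset \<pi>" by auto
    then have "finite (range (\<lambda>k. a + k * A))" using finite_subset by blast
    moreover have "inj (\<lambda>k. a + k * A)" using A by (auto intro: injI)
    ultimately show False using finite_imageD infinite_UNIV_nat by blast
  qed
  then show "a + run_length A a \<pi> * A \<notin># \<pi>" unfolding run_length_def by (rule LeastI_ex)
  show "i < run_length A a \<pi> \<Longrightarrow> a + i * A \<in># \<pi>" unfolding run_length_def
    using not_less_Least[of i "\<lambda>k. a + k * A \<notin># \<pi>"] by blast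
qed

lemma mex_eq_run_length:
  assumes "A \<ge> 1"
  shows "mex A a \<pi> = a + run_length A a \<pi> * A"
  unfolding mex_def
proof (rule Least_equality)
  show "(\<exists>k. a + run_length A a \<pi> * A = a + k * A) \<and> a + run_length A a \<pi> * A \<notin># \<pi>"
    using run_length_props(1)[OF assms] by blast
  fix x assume "(\<exists>k. x = a + k * A) \<and> x \<notin># \<pi>"
  then obtain k where "x = a + k * A" "x \<notin># \<pi>" by blast
  moreover from this have "run_length A a \<pi> \<le> k"
    using run_length_props(2)[OF assms] not_le by blast
  ultimately show "a + run_length A a \<pi> * A \<le> x" by simp
qed

text \<open>The mex is \<open>a\<close> plus \<open>A\<close> times the length of the run;
  cancelling \<open>a\<close> and then the factor \<open>A\<close> leaves a congruence modulo
  \<open>2\<close>.\<close>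

lemma mex_cong_iff:
  assumes "A \<ge> 1"
  shows "[mex A a \<pi> = A + a] (mod (2 * A)) \<longleftrightarrow> odd (run_length A a \<pi>)"
proof -
  let ?k = "run_length A a \<pi>"
  have "[mex A a \<pi> = A + a] (mod (2 * A)) \<longleftrightarrow> [?k * A + a = 1 * A + a] (mod (2 * A))"
    by (simp add: mex_eq_run_length[OF assms] add.commute)
  also have "\<dots> \<longleftrightarrow> [?k * A = 1 * A] (mod (2 * A))" by (rule cong_add_rcancel_nat)
  also have "\<dots> \<longleftrightarrow> [?k = 1] (mod 2)" using assms by (simp add: cong_def mult_mod_left[symmetric] del: mult_1)
  also have "\<dots> \<longleftrightarrow> odd ?k" by (simp add: cong_def odd_iff_mod_2_eq_one)
  finally show ?thesis .
qed

lemma pbar_eq: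
  "A \<ge> 1 \<Longrightarrow> pbar A a n = card {\<pi> \<in> partitions n. odd (run_length A a \<pi>)}"
  by (simp add: pbar_def mex_cong_iff)

lemma run_length_eq_0: "a \<notin># \<pi> \<Longrightarrow> run_length A a \<pi> = 0"
  by (rule run_length_eqI) auto

lemma run_length_add_mset:
  assumes "A \<ge> 1"
  shows "run_length A a (add_mset a \<pi>) = Suc (run_length A (a + A) \<pi>)"
proof (rule run_length_eqI)
  show "a + Suc (run_length A (a + A) \<pi>) * A \<notin># add_mset a \<pi>"
    using run_length_props(1)[OF assms, of "a + A" \<pi>] assms by (simp add: algebra_simps)
  fix i assume "i < Suc (run_length A (a + A) \<pi>)"
  then show "a + i * A \<in># add_mset a \<pi>"
    using run_length_props(2)[OF assms, of "i - 1" "a + A" \<pi>] by (cases i) (auto simp: algebra_simps)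
qed

text \<open>An odd run starting at \<open>a\<close> contains \<open>a\<close>; deleting one copy of
  it leaves an even run starting at \<open>a + A\<close>, the complement of what the second summand
  counts.\<close>

lemma pbar_rec:
  assumes "A \<ge> 1" "a \<ge> 1"
  shows "pbar A a (n + a) + pbar A (a + A) n = card (partitions n)"
proof -
  let ?S = "{\<pi> \<in> partitions n. even (run_length A (a + A) \<pi>)}"
  let ?T = "{\<pi> \<in> partitions (n + a). odd (run_length A a \<pi>)}"
  have "bij_betw (add_mset a) ?S ?T"
  proof (rule bij_betw_imageI)
    show "add_mset a ` ?S = ?T"
    proof (intro equalityI subsetI)
      fix \<pi> assume \<pi>: "\<pi> \<in> ?T"
      then have "a \<in># \<pi>" using run_length_eq_0[of a \<pi> A] by (cases "a \<in># \<pi>") auto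
      then obtain \<rho> where "\<pi> = add_mset a \<rho>" by (auto dest: multi_member_split)
      then show "\<pi> \<in> add_mset a ` ?S" using \<pi> assms by (auto simp: partitions_def run_length_add_mset)
    qed (use assms in \<open>auto simp: partitions_def run_length_add_mset\<close>)
  qed (auto intro: inj_onI)
  then have "card ?S = card ?T" by (rule bij_betw_same_card)
  then show ?thesis
    using card_filter_not[of "partitions n" "\<lambda>\<pi>. odd (run_length A (a + A) \<pi>)"]
    unfolding pbar_eq[OF assms(1)] by simp
qed

text \<open>Base of the recurrence: no part exceeds \<open>n\<close>, so the run from
  \<open>a\<close> is empty.\<close>

lemma pbar_eq_0:
  assumes "A \<ge> 1" "n < a"
  shows "pbar A a n = 0"
proof -
  have "run_length A a \<pi> = 0" if "\<pi> \<in> partitions n" for \<pi>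
  proof (rule run_length_eq_0)
    have "x \<le> n" if "x \<in># \<pi>" for x
      using \<open>\<pi> \<in> partitions n\<close> sum_mset.remove[OF that] by (simp add: partitions_def)
    then show "a \<notin># \<pi>" using assms(2) not_le by blast
  qed
  then show ?thesis using assms(1) by (simp add: pbar_eq)
qed

subsection \<open>Dyson's map and the rank\<close>

lemma conjugate_0_le: "f \<in> ferrers n \<Longrightarrow> conjugate f 0 \<le> n"
  by (rule ferrers_le[OF conjugate_ferrers])

text \<open>Trading the first column, of \<open>f 0\<close> cells, for a row of
  \<open>f 0 + r\<close> cells raises the size by \<open>r\<close>. The bound on the left says that
  this row is a largest part; afterwards there are \<open>f 1 + 1 \<le> f 0 + 1\<close> parts, so
  the rank is at least \<open>r - 1\<close>.\<close>

lemma card_dyson_map: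
  assumes r: "r \<ge> 1"
  shows "card {f \<in> ferrers n. conjugate f 0 \<le> f 0 + r + 1} = card {g \<in> ferrers (n + r). g 0 + r \<le> conjugate g 0 + 1}"
    (is "card ?S = card ?T")
proof -
  define \<phi> :: "(nat \<Rightarrow> nat) \<Rightarrow> nat \<Rightarrow> nat" where "\<phi> = (\<lambda>f k. f (Suc k) + (if k < f 0 + r then 1 else 0))"
  \<comment> \<open>The inverse: one cell is removed from every nonempty column, which deletes the
    largest part, and a column is put in front.\<close>
  define \<psi> :: "(nat \<Rightarrow> nat) \<Rightarrow> nat \<Rightarrow> nat" where "\<psi> = (\<lambda>g k. case k of 0 \<Rightarrow> conjugate g 0 - r | Suc k \<Rightarrow> g k - 1)"
  have S: "f (Suc k) = 0" if "f \<in> ?S" "\<not> k < f 0 + r" for f k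
    using that less_conjugate_iff[of f n "Suc k" 0] by auto
  have conjugate_\<phi>: "conjugate (\<phi> f) 0 = f 0 + r" if "f \<in> ?S" for f
    using S[OF that] by (intro conjugate_eqI) (auto simp: \<phi>_def)
  have T: "g 0 \<ge> 1" "r \<le> conjugate g 0" "\<And>k. k < conjugate g 0 \<longleftrightarrow> 0 < g k" "g \<in> ferrers (n + r)"
    if "g \<in> ?T" for g
  proof -
    show g: "g \<in> ferrers (n + r)" using that by simp
    show *: "k < conjugate g 0 \<longleftrightarrow> 0 < g k" for k using less_conjugate_iff[OF g] .
    show "g 0 \<ge> 1"
    proof (rule ccontr)
      assume "\<not> g 0 \<ge> 1"
      then have "g k = 0" for k using ferrers_antimono[OF g, of 0 k] by simp
      then show False using ferrers_sum_self[OF g] r by simp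
    qed
    then show "r \<le> conjugate g 0" using that by simp
  qed
  have "\<phi> f \<in> ?T" if f: "f \<in> ?S" for f
  proof -
    have fn: "f \<in> ferrers n" using f by simp
    have "\<phi> f \<in> ferrers (n + r)"
    proof (rule ferrersI)
      show "\<phi> f (Suc k) \<le> \<phi> f k" for k
        using ferrers_antimono[OF fn, of "Suc k" "Suc (Suc k)"] by (auto simp: \<phi>_def)
      show "\<phi> f k = 0" if "n + r \<le> k" for k
        using that ferrers_eq_0[OF fn, of "Suc k"] ferrers_le[OF fn, of 0] by (simp add: \<phi>_def)
      have "{k \<in> {..<n + r}. k < f 0 + r} = {..<f 0 + r}" using ferrers_le[OF fn, of 0] by auto
      then have "sum (\<phi> f) {..<n + r} = (\<Sum>k<n + r. f (Suc k)) + (f 0 + r)"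
        by (simp add: \<phi>_def sum.distrib sum.If_cases Int_def)
      also have "\<dots> = sum f {..<Suc (n + r)} + r" by (subst sum.lessThan_Suc_shift) simp
      also have "sum f {..<Suc (n + r)} = n" using ferrers_eq_0[OF fn] by (intro ferrers_sum[OF fn]) auto
      finally show "sum (\<phi> f) {..<n + r} = n + r" .
    qed
    moreover have "\<phi> f 0 = f 1 + 1" using r by (simp add: \<phi>_def)
    ultimately show ?thesis using conjugate_\<phi>[OF f] ferrers_antimono[OF fn, of 0 1] by simp
  qed
  moreover have "\<psi> g \<in> ?S" if g: "g \<in> ?T" for g
  proof -
    note gT = T[OF g]
    have "\<psi> g \<in> ferrers n"
    proof (rule ferrersI)
      show "\<psi> g (Suc k) \<le> \<psi> g k" for k
        using gT(1,2) g ferrers_antimono[OF gT(4), of "k - 1" k] by (auto simp: \<psi>_def split: nat.split)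
      show "\<psi> g k = 0" if "Suc (n + r) \<le> k" for k
        using that ferrers_eq_0[OF gT(4), of "k - 1"] by (auto simp: \<psi>_def split: nat.split)
      have "{k \<in> {..<n + r}. k < conjugate g 0} = {..<conjugate g 0}" using conjugate_0_le[OF gT(4)] by auto
      then have "(\<Sum>k<n + r. g k - 1) + conjugate g 0 = (\<Sum>k<n + r. g k - 1 + (if k < conjugate g 0 then 1 else 0))"
        by (simp add: sum.distrib sum.If_cases Int_def)
      also have "\<dots> = sum g {..<n + r}" using gT(3) by (intro sum.cong) auto
      also have "\<dots> = n + r" using ferrers_sum_self[OF gT(4)] .
      finally show "sum (\<psi> g) {..<Suc (n + r)} = n"
        using gT(2) by (subst sum.lessThan_Suc_shift) (simp add: \<psi>_def)
    qed
    moreover have "conjugate (\<psi> g) 0 \<le> conjugate g 0 + 1"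
    proof (rule ccontr)
      assume "\<not> ?thesis"
      then have "0 < \<psi> g (Suc (conjugate g 0))" using less_conjugate_iff[OF \<open>\<psi> g \<in> ferrers n\<close>, of "Suc (conjugate g 0)" 0] by simp
      then show False using gT(3)[of "conjugate g 0"] by (simp add: \<psi>_def)
    qed
    ultimately show ?thesis using gT(2) by (simp add: \<psi>_def)
  qed
  moreover have "\<psi> (\<phi> f) = f" if "f \<in> ?S" for f
    using conjugate_\<phi>[OF that] S[OF that] by (auto simp: \<psi>_def fun_eq_iff split: nat.split) (auto simp: \<phi>_def)
  moreover have "\<phi> (\<psi> g) = g" if "g \<in> ?T" for g
    using T(2,3)[OF that] by (auto simp: \<phi>_def \<psi>_def fun_eq_iff)
  ultimately have "bij_betw \<phi> ?S ?T" by (intro bij_betw_byWitness[where f' = \<psi>]) auto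
  then show ?thesis by (rule bij_betw_same_card)
qed

text \<open>Dyson's map with \<open>r = j + 1\<close> yields the recurrence of
  \<open>pbar_rec\<close> for \<open>A = 3\<close>: rank at least \<open>j\<close> at size
  \<open>n\<close> corresponds to the complement of rank at least \<open>j + 3\<close> at size
  \<open>n - (j + 1)\<close>.\<close>

lemma card_rank_ge:
  assumes "j \<ge> 1"
  shows "card {f \<in> ferrers n. f 0 + j \<le> conjugate f 0} = pbar 3 (j + 1) n"
  using assms
proof (induction n arbitrary: j rule: less_induct)
  case (less n)
  show ?case
  proof (cases "n < j + 1")
    case True
    \<comment> \<open>A nonempty diagram has rank at most \<open>n - 1\<close>, which is below
      \<open>j\<close>; the empty one has rank \<open>0\<close>.\<close>
    have "\<not> f 0 + j \<le> conjugate f 0" if f: "f \<in> ferrers n" for f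
      using less_conjugate_iff[OF f, of 0 0] conjugate_0_le[OF f] less.prems True by linarith
    then have "{f \<in> ferrers n. f 0 + j \<le> conjugate f 0} = {}" by blast
    then show ?thesis using True by (simp add: pbar_eq_0)
  next
    case False
    define m where "m = n - (j + 1)"
    have n: "n = m + (j + 1)" using False by (simp add: m_def)
    have "card {f \<in> ferrers n. f 0 + j \<le> conjugate f 0} + card {f \<in> ferrers m. f 0 + (j + 3) \<le> conjugate f 0} = card (ferrers m)"
    proof -
      have "conjugate f 0 \<le> f 0 + (j + 1) + 1 \<longleftrightarrow> \<not> f 0 + (j + 3) \<le> conjugate f 0"
        "f 0 + (j + 1) \<le> conjugate f 0 + 1 \<longleftrightarrow> f 0 + j \<le> conjugate f 0" for f by linarith+
      then show ?thesis
        using card_dyson_map[of "j + 1" m] card_filter_not[OF finite_ferrers, of m "\<lambda>f. f 0 + (j + 3) \<le> conjugate f 0"]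
        unfolding n by presburger
    qed
    moreover have "card {f \<in> ferrers m. f 0 + (j + 3) \<le> conjugate f 0} = pbar 3 (j + 1 + 3) m"
      using less.IH[of m "j + 3"] n by (simp add: add.commute add.left_commute)
    moreover have "pbar 3 (j + 1) n + pbar 3 (j + 1 + 3) m = card (ferrers m)"
      using pbar_rec[of 3 "j + 1" m] unfolding n card_partitions by simp
    ultimately show ?thesis by linarith
  qed
qed

section \<open>Tail counts of the rank for partitions\<close>

lemma rank_eq: "\<pi> \<in> partitions n \<Longrightarrow> rank \<pi> = int (conjugate (cols \<pi>) 0) - int (cols \<pi> 0)"
  unfolding rank_def largest_part_eq_conjugate using cols_0[of \<pi>] by (simp add: partitions_def)

lemma rank_ge_iff: "\<pi> \<in> partitions n \<Longrightarrow> rank \<pi> \<ge> int j \<longleftrightarrow> cols \<pi> 0 + j \<le> conjugate (cols \<pi>) 0"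
  by (drule rank_eq) linarith

lemma rank_le_iff: "\<pi> \<in> partitions n \<Longrightarrow> rank \<pi> \<le> - int j \<longleftrightarrow> conjugate (cols \<pi>) 0 + j \<le> cols \<pi> 0"
  by (drule rank_eq) linarith

lemma card_partitions_rank_ge:
  assumes "j \<ge> 1"
  shows "card {\<pi> \<in> partitions n. rank \<pi> \<ge> int j} = pbar 3 (j + 1) n"
proof -
  have "card {\<pi> \<in> partitions n. rank \<pi> \<ge> int j} = card {\<pi> \<in> partitions n. cols \<pi> 0 + j \<le> conjugate (cols \<pi>) 0}"
    by (intro arg_cong[where f = card] Collect_cong conj_cong refl rank_ge_iff)
  also have "\<dots> = card {f \<in> ferrers n. f 0 + j \<le> conjugate f 0}" by (rule card_partitions_cols)
  finally show ?thesis using card_rank_ge[OF assms, of n] by simp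
qed

text \<open>Conjugation exchanges the largest part and the number of parts, hence negates the
  rank.\<close>

lemma card_partitions_rank_le:
  assumes "j \<ge> 1"
  shows "card {\<pi> \<in> partitions n. rank \<pi> \<le> - int j} = pbar 3 (j + 1) n"
proof -
  have "card {\<pi> \<in> partitions n. rank \<pi> \<le> - int j} = card {\<pi> \<in> partitions n. conjugate (cols \<pi>) 0 + j \<le> cols \<pi> 0}"
    by (intro arg_cong[where f = card] Collect_cong conj_cong refl rank_le_iff)
  also have "\<dots> = card {f \<in> ferrers n. conjugate f 0 + j \<le> f 0}" by (rule card_partitions_cols)
  also have "\<dots> = card {f \<in> ferrers n. conjugate f 0 + j \<le> conjugate (conjugate f) 0}"
    by (intro arg_cong[where f = card] Collect_cong conj_cong refl) (simp only: conjugate_conjugate)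
  also have "\<dots> = card {f \<in> ferrers n. f 0 + j \<le> conjugate f 0}"
    by (rule card_ferrers_conjugate)
  finally show ?thesis using card_rank_ge[OF assms, of n] by simp
qed

subsection \<open>Inserting a row at the corner\<close>

text \<open>The effect on the size when \<open>c\<close> columns of height \<open>b\<close> are
  inserted at position \<open>s\<close> and the later columns move to the right.\<close>

lemma sum_insert_block:
  fixes a h :: "nat \<Rightarrow> nat"
  shows "(\<Sum>k<s + c + t. if k < s then a k else if k < s + c then b else h (k - c))
    = sum a {..<s} + c * b + sum h {s..<s + t}"
proof (induction t)
  case 0
  have "(\<Sum>k<s + c. if k < s then a k else b) = sum a {..<s} + c * b" by (induction c) simp_all
  moreover have "(\<Sum>k<s + c. if k < s then a k else if k < s + c then b else h (k - c))
      = (\<Sum>k<s + c. if k < s then a k else b)" by (intro sum.cong) auto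
  ultimately show ?case by simp
next
  case (Suc t)
  then show ?case by (simp add: add.assoc)
qed

definition ones :: "(nat \<Rightarrow> nat) \<Rightarrow> nat" where "ones f = f 0 - f 1"

text \<open>By rows, under \<open>corner_data\<close>: a row \<open>d + 1\<close> of length
  \<open>d + 1 + i + c\<close> is inserted, and each of the \<open>d\<close> rows above grows by
  \<open>c\<close>. Column \<open>0\<close> still includes the ones that pay for this.\<close>

definition corner_body :: "nat \<Rightarrow> nat \<Rightarrow> nat \<Rightarrow> (nat \<Rightarrow> nat) \<Rightarrow> nat \<Rightarrow> nat" where
  "corner_body i d c g k = (if k \<le> d + i then g k + 1 else if k \<le> d + i + c then d + 1 else g (k - c))"

text \<open>Measuring column \<open>0\<close> from column \<open>1\<close> leaves exactly
  \<open>r\<close> ones.\<close>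

definition corner_insert :: "nat \<Rightarrow> nat \<Rightarrow> nat \<Rightarrow> nat \<Rightarrow> (nat \<Rightarrow> nat) \<Rightarrow> nat \<Rightarrow> nat" where
  "corner_insert i d c r g k = (if k = 0 then corner_body i d c g 1 + r else corner_body i d c g k)"

text \<open>
  A diagram \<open>g\<close> with \<open>\<omega>\<close> ones and \<open>g (\<omega> + i + 1) \<le> \<omega>\<close> has a unique corner \<open>d\<close>, and \<open>c\<close> and \<open>r\<close> are
  quotient and remainder of \<open>\<omega> - d\<close> by \<open>d + 1\<close>. The inverse of the row-moving map spends \<open>\<omega> - r\<close>
  of the ones on a new row \<open>d + 1\<close> of length \<open>d + 1 + i + c\<close>, adding \<open>c\<close> to each row above it;
  \<open>r \<le> d\<close> ones remain. The last condition excludes the row of length \<open>1\<close>, which would itself be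
  a one.
\<close>

definition corner_data :: "nat \<Rightarrow> nat \<Rightarrow> nat \<Rightarrow> nat \<Rightarrow> (nat \<Rightarrow> nat) \<Rightarrow> bool" where
  "corner_data i d c r g \<longleftrightarrow> g 0 = g 1 + d + c * (d + 1) + r \<and> r \<le> d \<and> g (d + i + 1) \<le> d
     \<and> (d + i \<ge> 1 \<longrightarrow> d \<le> g (d + i)) \<and> d + i + c \<ge> 1"

text \<open>The ones lose \<open>d + c * (d + 1)\<close> cells and the rows gain
  \<open>d + i + 1 + c * (d + 1)\<close>, a net gain of \<open>i + 1\<close>. The bounds on
  \<open>g\<close> at both sides of the block keep the columns decreasing.\<close>

lemma corner_insert_ferrers:
  assumes g: "g \<in> ferrers m" and dom: "corner_data i d c r g"
  shows "corner_insert i d c r g \<in> ferrers (m + i + 1)"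
proof -
  define K where "K = d + i + 1 + c + m"
  have body0: "corner_body i d c g 0 = g 0 + 1" by (simp add: corner_body_def)
  \<comment> \<open>For \<open>d = i = 0\<close> column \<open>1\<close> already belongs to the
    inserted block, so that case is computed separately.\<close>
  have f0: "corner_insert i d c r g 0 + d + c * (d + 1) = g 0 + 1"
  proof (cases "d + i \<ge> 1")
    case True
    then have "corner_body i d c g 1 = g 1 + 1" by (simp add: corner_body_def)
    then show ?thesis using dom by (simp add: corner_insert_def corner_data_def)
  next
    case False
    then have "d = 0" "i = 0" by auto
    moreover from this have "c \<ge> 1" "r = 0" "g 1 = 0" using dom by (auto simp: corner_data_def)
    ultimately show ?thesis using dom by (simp add: corner_insert_def corner_data_def corner_body_def)
  qed
  have zero: "corner_insert i d c r g k = 0" if "k \<ge> K" for k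
    using that ferrers_eq_0[OF g, of "k - c"] by (simp add: corner_insert_def corner_body_def K_def)
  \<comment> \<open>The size is computed for \<open>corner_body\<close>, which is a pure block
    insertion; the two functions differ only in column \<open>0\<close>.\<close>
  have "sum (corner_body i d c g) {..<K} = (\<Sum>k<(d + i + 1) + c + m. if k < d + i + 1 then g k + 1
      else if k < d + i + 1 + c then d + 1 else g (k - c))"
    unfolding K_def by (intro sum.cong) (auto simp: corner_body_def)
  also have "\<dots> = (\<Sum>k<d + i + 1. g k + 1) + c * (d + 1) + sum g {d + i + 1..<d + i + 1 + m}"
    by (rule sum_insert_block)
  also have "\<dots> = sum g {..<d + i + 1} + sum g {d + i + 1..<d + i + 1 + m} + (d + i + 1) + c * (d + 1)"
    unfolding sum.distrib by simp
  also have "sum g {..<d + i + 1} + sum g {d + i + 1..<d + i + 1 + m} = sum g {..<d + i + 1 + m}"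
    unfolding lessThan_atLeast0 by (rule sum.atLeastLessThan_concat) auto
  also have "\<dots> = m" using ferrers_eq_0[OF g] by (intro ferrers_sum[OF g]) auto
  finally have body: "sum (corner_body i d c g) {..<K} = m + (d + i + 1) + c * (d + 1)" .
  have "{..<K} = insert 0 {1..<K}" by (auto simp: K_def)
  then have "sum (corner_body i d c g) {..<K} = g 0 + 1 + sum (corner_body i d c g) {1..<K}"
    "sum (corner_insert i d c r g) {..<K} = corner_insert i d c r g 0 + sum (corner_body i d c g) {1..<K}"
    using body0 by (auto simp: corner_insert_def intro!: sum.cong)
  then have sum: "sum (corner_insert i d c r g) {..<K} = m + i + 1" using body f0 by linarith
  have "corner_insert i d c r g (Suc k) \<le> corner_insert i d c r g k" for k
  proof (cases "k = 0")
    case True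
    then show ?thesis by (simp add: corner_insert_def)
  next
    case False
    consider "k < d + i" | "k = d + i" | "d + i < k" "k < d + i + c" | "d + i < k" "k = d + i + c" | "k > d + i + c"
      by linarith
    then have "corner_body i d c g (Suc k) \<le> corner_body i d c g k"
    proof cases
      case 1
      then show ?thesis using ferrers_antimono[OF g, of k "Suc k"] by (simp add: corner_body_def)
    next
      case 2
      then show ?thesis using False dom by (cases "c = 0") (auto simp: corner_body_def corner_data_def)
    next
      case 4
      then show ?thesis using dom by (auto simp: corner_body_def corner_data_def Suc_diff_le)
    next
      case 5
      then show ?thesis using ferrers_antimono[OF g, of "k - c" "Suc k - c"] by (simp add: corner_body_def)
    qed (simp add: corner_body_def)
    then show ?thesis using False by (simp add: corner_insert_def)
  qed
  then show ?thesis using zero sum by (rule ferrersI)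
qed

section \<open>Recovering the corner data\<close>

lemma ones_corner_insert: "ones (corner_insert i d c r g) = r"
  by (simp add: ones_def corner_insert_def)

text \<open>The rectangle of \<open>d + 1\<close> rows and \<open>d + 1 + i\<close> columns fits
  into the image, the next larger one of the same excess does not: this is the corner of the Durfee
  rectangle.\<close>

lemma corner_insert_corner:
  assumes "corner_data i d c r g"
  shows "d < corner_insert i d c r g (d + i)" "corner_insert i d c r g (d + i + 1) \<le> d + 1"
proof -
  show "d < corner_insert i d c r g (d + i)"
    using assms by (cases "d + i \<ge> 1") (auto simp: corner_insert_def corner_data_def corner_body_def)
  show "corner_insert i d c r g (d + i + 1) \<le> d + 1"
    using assms by (cases "c = 0") (auto simp: corner_insert_def corner_data_def corner_body_def)
qed

text \<open>To the right of the rectangle exactly the inserted columns reach height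
  \<open>d + 1\<close>, which recovers \<open>c\<close>.\<close>

lemma corner_insert_block:
  assumes g: "g \<in> ferrers m" and "corner_data i d c r g"
  shows "d + 1 \<le> corner_insert i d c r g (d + i + 1 + t) \<longleftrightarrow> t < c"
proof -
  have "g (d + i + 1 + t - c) \<le> d" if "c \<le> t"
  proof -
    have "g (d + i + 1 + t - c) \<le> g (d + i + 1)" using that by (intro ferrers_antimono[OF g]) simp
    then show ?thesis using assms(2) by (simp add: corner_data_def)
  qed
  then show ?thesis by (auto simp: corner_insert_def corner_body_def)
qed

text \<open>For \<open>d < d'\<close> monotonicity would give
  \<open>d' < f (d' + i) \<le> f (d + i + 1) \<le> d + 1 \<le> d'\<close>.\<close>

lemma corner_unique:
  assumes f: "f \<in> ferrers n"
    and "d < f (d + i)" "f (d + i + 1) \<le> d + 1" "d' < f (d' + i)" "f (d' + i + 1) \<le> d' + 1"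
  shows "d = d'"
proof (rule ccontr)
  assume "d \<noteq> d'"
  then consider "d < d'" | "d' < d" by linarith
  then show False
  proof cases
    case 1
    then show False using ferrers_antimono[OF f, of "d + i + 1" "d' + i"] assms by linarith
  next
    case 2
    then show False using ferrers_antimono[OF f, of "d' + i + 1" "d + i"] assms by linarith
  qed
qed

text \<open>The image determines \<open>d\<close> as its corner and \<open>c\<close> as the width of
  its block. The columns of \<open>g\<close> from \<open>1\<close> on are then read off, and column
  \<open>0\<close> follows from the size.\<close>

lemma corner_insert_inj:
  assumes g: "g \<in> ferrers m" and dom: "corner_data i d c r g"
    and g': "g' \<in> ferrers m" and dom': "corner_data i d' c' r' g'"
    and eq: "corner_insert i d c r g = corner_insert i d' c' r' g'"
  shows "g = g'"
proof -
  have d: "d' = d"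
    using corner_unique[OF corner_insert_ferrers[OF g dom] corner_insert_corner[OF dom]] corner_insert_corner[OF dom'] eq by metis
  have "t < c \<longleftrightarrow> t < c'" for t
    using corner_insert_block[OF g dom, of t] corner_insert_block[OF g' dom', of t] eq d by metis
  then have c: "c' = c" by (metis less_irrefl linorder_neqE_nat)
  show ?thesis
  proof (rule ferrers_eqI[OF g g'])
    fix k :: nat assume k: "k \<ge> 1"
    show "g k = g' k"
    proof (cases "k \<le> d + i")
      case True
      then show ?thesis using fun_cong[OF eq, of k] k d c by (simp add: corner_insert_def corner_body_def)
    next
      case False
      then show ?thesis using fun_cong[OF eq, of "k + c"] k d c by (simp add: corner_insert_def corner_body_def)
    qed
  qed
qed

text \<open>As \<open>d\<close> grows, \<open>g (d + i)\<close> does not, so the two cross only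
  once; \<open>c\<close> and \<open>r\<close> are then quotient and remainder.\<close>

lemma corner_data_unique:
  assumes g: "g \<in> ferrers m" and dom: "corner_data i d c r g" and dom': "corner_data i d' c' r' g"
  shows "d = d' \<and> c = c' \<and> r = r'"
proof -
  have d: "d = d'"
  proof (rule ccontr)
    assume "d \<noteq> d'"
    then consider "d < d'" | "d' < d" by linarith
    then show False
    proof cases
      case 1
      then show False using ferrers_antimono[OF g, of "d + i + 1" "d' + i"] dom dom'
        unfolding corner_data_def by linarith
    next
      case 2
      then show False using ferrers_antimono[OF g, of "d' + i + 1" "d + i"] dom dom'
        unfolding corner_data_def by linarith
    qed
  qed
  define q where "q = g 0 - g 1 - d"
  have "q = c * (d + 1) + r" "q = c' * (d + 1) + r'" "r < d + 1" "r' < d + 1"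
    using dom dom' d by (auto simp: corner_data_def q_def)
  then have "c = q div (d + 1)" "c' = q div (d + 1)" "r = q mod (d + 1)" "r' = q mod (d + 1)"
    by (metis div_mult_self3 div_less add_0_right less_nat_zero_code, metis div_mult_self3 div_less add_0_right less_nat_zero_code,
      metis mod_mult_self3 mod_less, metis mod_mult_self3 mod_less)
  then show ?thesis using d by simp
qed

text \<open>The hypothesis places \<open>ones g\<close> at or beyond the corner, so
  \<open>ones g - d\<close> is a true difference to be divided by \<open>d + 1\<close>.\<close>

lemma corner_insert_exists:
  assumes g: "g \<in> ferrers m" and le: "g (ones g + i + 1) \<le> ones g" and mi: "m + i \<ge> 1"
  shows "\<exists>d c r. corner_data i d c r g"
proof -
  define d where "d = (LEAST d. g (d + i + 1) \<le> d)"
  have d: "g (d + i + 1) \<le> d" unfolding d_def using le by (rule LeastI)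
  have "d \<le> ones g" unfolding d_def using le by (rule Least_le)
  have di: "d \<le> g (d + i)"
    using not_less_Least[of "d - 1" "\<lambda>d. g (d + i + 1) \<le> d"] unfolding d_def[symmetric] by (cases d) auto
  define q where "q = ones g - d"
  have "g 0 = g 1 + ones g" using ferrers_antimono[OF g, of 0 1] by (simp add: ones_def)
  then have g0: "g 0 = g 1 + d + q" using \<open>d \<le> ones g\<close> by (simp add: q_def)
  have q: "q = q div (d + 1) * (d + 1) + q mod (d + 1)" by (metis div_mult_mod_eq)
  \<comment> \<open>Failure would mean \<open>i = 0\<close> and an empty \<open>g\<close>, against
    \<open>mi\<close>.\<close>
  have "d + i + q div (d + 1) \<ge> 1"
  proof (rule ccontr)
    assume neg: "\<not> ?thesis"
    then have di0: "d = 0" "i = 0" by auto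
    have "q = 0" using neg unfolding di0 by simp
    note * = di0 this
    then have "g 0 = 0" using g0 d by simp
    then have "m = 0" using ferrers_sum[OF g, of 0] ferrers_antimono[OF g, of 0] by simp
    then show False using mi * by simp
  qed
  moreover have "q mod (d + 1) \<le> d" using mod_less_divisor[of "d + 1" q] by linarith
  ultimately have "corner_data i d (q div (d + 1)) (q mod (d + 1)) g"
    unfolding corner_data_def using d di g0 q by simp
  then show ?thesis by blast
qed

lemma corner_insert_target:
  assumes g: "g \<in> ferrers m" and dom: "corner_data i d c r g"
  shows "ones (corner_insert i d c r g) < corner_insert i d c r g (ones (corner_insert i d c r g) + i)"
proof -
  have "corner_insert i d c r g (d + i) \<le> corner_insert i d c r g (r + i)"
    using dom by (intro ferrers_antimono[OF corner_insert_ferrers[OF g dom]]) (simp add: corner_data_def)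
  then show ?thesis using corner_insert_corner(1)[OF dom] dom by (simp add: ones_corner_insert corner_data_def)
qed

text \<open>The row at the corner and \<open>c\<close> cells from each row above are removed;
  \<open>i + 1\<close> of these cells are dropped and the others become ones.\<close>

lemma corner_insert_surj:
  assumes f: "f \<in> ferrers (m + i + 1)" and gt: "ones f < f (ones f + i)"
  shows "\<exists>g d c r. g \<in> ferrers m \<and> corner_data i d c r g \<and> corner_insert i d c r g = f"
proof -
  define r where "r = ones f"
  define d where "d = (LEAST d. f (d + i + 1) \<le> d + 1)"
  have "f (m + i + 1 + i + 1) \<le> m + i + 1 + 1" using ferrers_eq_0[OF f] by simp
  then have d: "f (d + i + 1) \<le> d + 1" unfolding d_def by (rule LeastI)
  have rd: "r \<le> d"
  proof (rule ccontr)
    assume "\<not> r \<le> d"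
    then show False using ferrers_antimono[OF f, of "d + i + 1" "r + i"] gt d by (simp add: r_def)
  qed
  have di: "d < f (d + i)"
  proof (cases d)
    case 0
    then show ?thesis using rd gt by (simp add: r_def)
  next
    case (Suc e)
    then show ?thesis
      using not_less_Least[of e "\<lambda>d. f (d + i + 1) \<le> d + 1"] unfolding d_def[symmetric] by simp
  qed
  \<comment> \<open>The number of columns of height \<open>d + 1\<close> directly after the
    rectangle, as \<open>block\<close> shows.\<close>
  define c where "c = (LEAST t. f (d + i + 1 + t) \<le> d)"
  have "f (d + i + 1 + (m + i + 1)) \<le> d" using ferrers_eq_0[OF f] by simp
  then have c: "f (d + i + 1 + c) \<le> d" unfolding c_def by (rule LeastI)
  have block: "f k = d + 1" if "d + i + 1 \<le> k" "k \<le> d + i + c" for k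
  proof -
    have "\<not> f (d + i + 1 + (k - (d + i + 1))) \<le> d"
      using that unfolding c_def by (intro not_less_Least) linarith
    then show ?thesis using that d ferrers_antimono[OF f, of "d + i + 1" k] by simp
  qed
  define h where "h k = (if k \<le> d + i then f k - 1 else f (k + c))" for k
  define g where "g k = (if k = 0 then h 1 + d + c * (d + 1) + r else h k)" for k
  have h_mono: "h (Suc k) \<le> h k" for k
  proof -
    consider "k < d + i" | "k = d + i" | "k > d + i" by linarith
    then show ?thesis
    proof cases
      case 1
      then show ?thesis using ferrers_antimono[OF f, of k "Suc k"] by (simp add: h_def diff_le_mono)
    next
      case 2
      then show ?thesis using di c by (simp add: h_def add.commute add.left_commute)
    next
      case 3
      then show ?thesis using ferrers_antimono[OF f, of "k + c" "Suc k + c"] by (simp add: h_def)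
    qed
  qed
  \<comment> \<open>The size of \<open>g\<close> is left open here; comparing sizes after the
    insertion forces it to be \<open>m\<close>.\<close>
  have "g \<in> ferrers (sum g {..<d + 2 * i + m + 2})"
  proof (rule ferrersI)
    show "g (Suc k) \<le> g k" for k using h_mono[of k] by (cases k) (simp_all add: g_def)
    show "g k = 0" if "d + 2 * i + m + 2 \<le> k" for k
      using that ferrers_eq_0[OF f, of "k + c"] by (simp add: g_def h_def)
  qed simp
  then obtain m' where g: "g \<in> ferrers m'" by blast
  have g1: "g 1 = h 1" by (simp add: g_def)
  have fr: "f 0 = f 1 + r" using ferrers_antimono[OF f, of 0 1] by (simp add: r_def ones_def)
  have dom: "corner_data i d c r g"
    unfolding corner_data_def
  proof (intro conjI impI)
    show "g 0 = g 1 + d + c * (d + 1) + r" unfolding g1 by (simp add: g_def)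
    show "g (d + i + 1) \<le> d" using c by (simp add: g_def h_def add.commute add.left_commute)
    have "g (d + i) = f (d + i) - 1" if "1 \<le> d + i" using that by (simp add: g_def h_def)
    then show "d \<le> g (d + i)" if "1 \<le> d + i" using that di by linarith
    show "1 \<le> d + i + c"
    proof (rule ccontr)
      assume "\<not> ?thesis"
      then have "d = 0" "i = 0" "c = 0" by auto
      then show False using c fr rd di by simp
    qed
  qed (rule rd)
  have body: "corner_body i d c g k = f k" if "k \<ge> 1" for k
  proof -
    have "f k \<ge> 1" if "k \<le> d + i" using that di ferrers_antimono[OF f, of k "d + i"] by simp
    then show ?thesis using that block[of k] by (auto simp: corner_body_def g_def h_def)
  qed
  have "corner_insert i d c r g = f"
    using body fr by (auto simp: corner_insert_def fun_eq_iff)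
  moreover have "m' = m"
  proof -
    have "f \<in> ferrers (m' + i + 1)" using corner_insert_ferrers[OF g dom] calculation by simp
    then show ?thesis using f unfolding ferrers_def using ferrers_sum f by fastforce
  qed
  ultimately show ?thesis using g dom by blast
qed

text \<open>A bijection given as a relation, so that \<open>d\<close>, \<open>c\<close> and
  \<open>r\<close> can stay existentially quantified.\<close>

lemma card_eq_by_relation:
  assumes "\<And>a. a \<in> A \<Longrightarrow> \<exists>b\<in>B. R a b" "\<And>b. b \<in> B \<Longrightarrow> \<exists>a\<in>A. R a b"
    and "\<And>a b b'. a \<in> A \<Longrightarrow> b \<in> B \<Longrightarrow> b' \<in> B \<Longrightarrow> R a b \<Longrightarrow> R a b' \<Longrightarrow> b = b'"
    and "\<And>a a' b. a \<in> A \<Longrightarrow> a' \<in> A \<Longrightarrow> b \<in> B \<Longrightarrow> R a b \<Longrightarrow> R a' b \<Longrightarrow> a = a'"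
  shows "card A = card B"
proof -
  obtain \<phi> where \<phi>: "\<And>a. a \<in> A \<Longrightarrow> \<phi> a \<in> B \<and> R a (\<phi> a)" using assms(1) by metis
  have "bij_betw \<phi> A B"
  proof (rule bij_betw_imageI)
    show "inj_on \<phi> A" using \<phi> assms(4) by (metis inj_onI)
    show "\<phi> ` A = B"
    proof
      show "\<phi> ` A \<subseteq> B" using \<phi> by blast
      show "B \<subseteq> \<phi> ` A" using \<phi> assms(2,3) by (metis image_eqI subsetI)
    qed
  qed
  then show ?thesis by (rule bij_betw_same_card)
qed

text \<open>For \<open>m = i = 0\<close> the right side counts the empty diagram, while the left
  side is \<open>0\<close>: the only diagram of size \<open>1\<close> is a single one. This is the
  source of the exceptional crank at \<open>n = 1\<close>.\<close>

lemma card_corner_insert: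
  assumes "m + i \<ge> 1"
  shows "card {f \<in> ferrers (m + i + 1). ones f < f (ones f + i)} = card {g \<in> ferrers m. g (ones g + i + 1) \<le> ones g}"
proof (rule card_eq_by_relation[where R = "\<lambda>f g. \<exists>d c r. corner_data i d c r g \<and> corner_insert i d c r g = f"])
  fix f assume "f \<in> {f \<in> ferrers (m + i + 1). ones f < f (ones f + i)}"
  then obtain g d c r where g: "g \<in> ferrers m" and dom: "corner_data i d c r g" and "corner_insert i d c r g = f"
    using corner_insert_surj[of f m i] by blast
  moreover have "d \<le> ones g" using dom by (simp add: corner_data_def ones_def)
  then have "g (ones g + i + 1) \<le> ones g"
    using dom ferrers_antimono[OF g, of "d + i + 1" "ones g + i + 1"] by (simp add: corner_data_def)
  ultimately show "\<exists>g\<in>{g \<in> ferrers m. g (ones g + i + 1) \<le> ones g}. \<exists>d c r. corner_data i d c r g \<and> corner_insert i d c r g = f"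
    by blast
next
  fix g assume *: "g \<in> {g \<in> ferrers m. g (ones g + i + 1) \<le> ones g}"
  then obtain d c r where dom: "corner_data i d c r g" using corner_insert_exists[of g m i] assms by blast
  moreover have "corner_insert i d c r g \<in> {f \<in> ferrers (m + i + 1). ones f < f (ones f + i)}"
    using corner_insert_ferrers corner_insert_target dom * by blast
  ultimately show "\<exists>f\<in>{f \<in> ferrers (m + i + 1). ones f < f (ones f + i)}. \<exists>d c r. corner_data i d c r g \<and> corner_insert i d c r g = f"
    by blast
next
  fix f g g' assume "g \<in> {g \<in> ferrers m. g (ones g + i + 1) \<le> ones g}" "g' \<in> {g \<in> ferrers m. g (ones g + i + 1) \<le> ones g}"
    "\<exists>d c r. corner_data i d c r g \<and> corner_insert i d c r g = f" "\<exists>d c r. corner_data i d c r g' \<and> corner_insert i d c r g' = f"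
  then show "g = g'" using corner_insert_inj by blast
next
  fix f f' g assume "g \<in> {g \<in> ferrers m. g (ones g + i + 1) \<le> ones g}"
    "\<exists>d c r. corner_data i d c r g \<and> corner_insert i d c r g = f" "\<exists>d c r. corner_data i d c r g \<and> corner_insert i d c r g = f'"
  then show "f = f'" using corner_data_unique by blast
qed

text \<open>The corner map gives the recurrence of \<open>pbar_rec\<close> for \<open>A = 1\<close>.
  The induction hypothesis is used with excess \<open>i + 1\<close>, so the excluded pair does not
  recur.\<close>

lemma card_ones_less:
  assumes "\<not> (n = 1 \<and> i = 0)"
  shows "card {f \<in> ferrers n. ones f < f (ones f + i)} = pbar 1 (i + 1) n"
  using assms
proof (induction n arbitrary: i rule: less_induct)
  case (less n)
  show ?case
  proof (cases "n < i + 1")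
    case True
    have "\<not> ones f < f (ones f + i)" if f: "f \<in> ferrers n" for f
      using ferrers_eq_0[OF f, of "ones f + i"] True by simp
    then have "{f \<in> ferrers n. ones f < f (ones f + i)} = {}" by blast
    then show ?thesis using True by (simp add: pbar_eq_0)
  next
    case False
    define m where "m = n - (i + 1)"
    have n: "n = m + (i + 1)" using False by (simp add: m_def)
    have mi: "m + i \<ge> 1" using less.prems n by (cases "i = 0") auto
    have "card {f \<in> ferrers n. ones f < f (ones f + i)} + card {f \<in> ferrers m. ones f < f (ones f + (i + 1))} = card (ferrers m)"
      using card_corner_insert[OF mi] card_filter_not[OF finite_ferrers, of m "\<lambda>f. ones f < f (ones f + (i + 1))"]
      by (simp add: n not_less)
    moreover have "card {f \<in> ferrers m. ones f < f (ones f + (i + 1))} = pbar 1 (i + 1 + 1) m"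
      using less.IH[of m "i + 1"] n by simp
    moreover have "pbar 1 (i + 1) n + pbar 1 (i + 1 + 1) m = card (ferrers m)"
      using pbar_rec[of 1 "i + 1" m] unfolding n card_partitions by simp
    ultimately show ?thesis by linarith
  qed
qed

subsection \<open>The crank\<close>

text \<open>Deleting \<open>a\<close> ones lowers column \<open>0\<close> by \<open>a\<close> and
  leaves the other columns alone.\<close>

lemma card_add_ones:
  "card {f \<in> ferrers (n + a). a \<le> ones f \<and> Q f} = card {f \<in> ferrers n. Q (f(0 := f 0 + a))}"
proof -
  have "bij_betw (\<lambda>f. f(0 := f 0 + a)) {f \<in> ferrers n. Q (f(0 := f 0 + a))} {f \<in> ferrers (n + a). a \<le> ones f \<and> Q f}"
    (is "bij_betw _ ?S ?T")
  proof (rule bij_betw_imageI)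
    have sum: "sum h {..<Suc n} = h 0 + sum h {1..n}" for h :: "nat \<Rightarrow> nat" and n
    proof -
      have "{..<Suc n} = insert 0 {1..n}" by auto
      then show ?thesis by simp
    qed
    show "inj_on (\<lambda>f. f(0 := f 0 + a)) ?S"
    proof (rule inj_onI)
      fix f g :: "nat \<Rightarrow> nat" assume eq: "f(0 := f 0 + a) = g(0 := g 0 + a)"
      show "f = g"
      proof
        fix k show "f k = g k" using fun_cong[OF eq, of k] by (cases "k = 0") auto
      qed
    qed
    show "(\<lambda>f. f(0 := f 0 + a)) ` ?S = ?T"
    proof (intro equalityI subsetI)
      fix g assume "g \<in> (\<lambda>f. f(0 := f 0 + a)) ` ?S"
      then obtain f where f: "f \<in> ferrers n" and g: "g = f(0 := f 0 + a)" "Q g" by auto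
      have "sum g {..<Suc n} = n + a"
        using ferrers_sum[OF f, of "Suc n"] ferrers_eq_0[OF f] unfolding sum g by simp
      moreover have "g (Suc k) \<le> g k" for k
        using ferrers_antimono[OF f, of k "Suc k"] by (cases "k = 0") (simp_all add: g)
      moreover have "g k = 0" if "Suc n \<le> k" for k using that ferrers_eq_0[OF f, of k] by (simp add: g)
      ultimately have "g \<in> ferrers (n + a)" by (intro ferrersI)
      moreover have "a \<le> ones g" using ferrers_antimono[OF f, of 0 1] by (simp add: g ones_def)
      ultimately show "g \<in> ?T" using g by simp
    next
      fix g assume gT: "g \<in> ?T"
      then have g: "g \<in> ferrers (n + a)" and a: "a \<le> ones g" by auto
      define f where "f = g(0 := g 0 - a)"
      have f0: "f 0 + a = g 0" "f 1 \<le> f 0"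
        using a ferrers_antimono[OF g, of 0 1] by (auto simp: f_def ones_def)
      have fg: "f(0 := f 0 + a) = g" using f0 by (auto simp: f_def)
      have "sum f {..<Suc (n + a)} + a = n + a"
        using ferrers_sum[OF g, of "Suc (n + a)"] ferrers_eq_0[OF g] f0(1) unfolding sum by (simp add: f_def)
      moreover have "f (Suc k) \<le> f k" for k
        using ferrers_antimono[OF g, of k "Suc k"] f0(2) by (cases "k = 0") (auto simp: f_def)
      moreover have "f k = 0" if "Suc (n + a) \<le> k" for k using that ferrers_eq_0[OF g, of k] by (simp add: f_def)
      ultimately have "f \<in> ferrers n" by (intro ferrersI[where K = "Suc (n + a)"]) auto
      then have "f \<in> ?S" using gT fg by simp
      then show "g \<in> (\<lambda>f. f(0 := f 0 + a)) ` ?S" using fg by force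
    qed
  qed
  then show ?thesis by (rule bij_betw_same_card[symmetric])
qed

text \<open>Conjugation moves the cell in row \<open>v\<close> and column \<open>k\<close> to row
  \<open>k\<close> and column \<open>v\<close>.\<close>

lemma card_less_swap: "card {f \<in> ferrers n. v < f k} = card {f \<in> ferrers n. k < f v}"
proof -
  have "card {f \<in> ferrers n. v < f k} = card {f \<in> ferrers n. v < conjugate f k}"
    by (rule card_ferrers_conjugate[symmetric])
  also have "\<dots> = card {f \<in> ferrers n. k < f v}"
    by (intro arg_cong[where f = card] Collect_cong conj_cong refl) (simp only: less_conjugate_iff)
  finally show ?thesis .
qed

text \<open>Columns of positive index do not see the \<open>a\<close> deleted ones, so
  \<open>card_add_ones\<close> reduces the claim to the swap without restriction.\<close>

lemma card_le_ones_swap: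
  assumes "k \<ge> 1" "v \<ge> 1"
  shows "card {f \<in> ferrers n. a \<le> ones f \<and> v < f k} = card {f \<in> ferrers n. a \<le> ones f \<and> k < f v}"
proof (cases "a \<le> n")
  case True
  then obtain m where n: "n = m + a" by (metis le_add_diff_inverse2)
  show ?thesis unfolding n card_add_ones using assms card_less_swap[of m v k] by simp
next
  case False
  have "\<not> a \<le> ones f" if f: "f \<in> ferrers n" for f
    using ferrers_le[OF f, of 0] False by (simp add: ones_def)
  then have empty: "{f \<in> ferrers n. a \<le> ones f \<and> P f} = {}" for P by blast
  show ?thesis by (simp only: empty)
qed

lemma card_ones_eq_swap:
  assumes "k \<ge> 1" "v \<ge> 1"
  shows "card {f \<in> ferrers n. ones f = a \<and> v < f k} = card {f \<in> ferrers n. ones f = a \<and> k < f v}"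
proof -
  have split: "card {f \<in> ferrers n. ones f = a \<and> P f} + card {f \<in> ferrers n. Suc a \<le> ones f \<and> P f}
    = card {f \<in> ferrers n. a \<le> ones f \<and> P f}" for P
  proof -
    have "{f \<in> ferrers n. a \<le> ones f \<and> P f}
      = {f \<in> ferrers n. ones f = a \<and> P f} \<union> {f \<in> ferrers n. Suc a \<le> ones f \<and> P f}" by auto
    then show ?thesis by (subst card_Un_disjoint[symmetric]) auto
  qed
  show ?thesis
    using split[of "\<lambda>f. v < f k"] split[of "\<lambda>f. k < f v"]
      card_le_ones_swap[OF assms, of n a] card_le_ones_swap[OF assms, of n "Suc a"] by linarith
qed

lemma card_split_ones:
  "card {f \<in> ferrers n. P f} = (\<Sum>a\<le>n. card {f \<in> ferrers n. ones f = a \<and> P f})"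
proof -
  have "{f \<in> ferrers n. P f} = (\<Union>a\<in>{..n}. {f \<in> ferrers n. ones f = a \<and> P f})"
    using ferrers_le[of _ n 0] by (fastforce simp: ones_def)
  then show ?thesis by (simp only:) (rule card_UN_disjoint, auto)
qed

section \<open>Tail counts of the crank for partitions\<close>

lemma ones_cols: "ones (cols \<pi>) = count \<pi> 1"
  using cols_Suc[of \<pi> 0] by (simp add: ones_def)

lemma crank_eq:
  "crank \<pi> = (if ones (cols \<pi>) = 0 then int (conjugate (cols \<pi>) 0)
    else int (cols \<pi> (ones (cols \<pi>))) - int (ones (cols \<pi>)))"
  unfolding crank_def ones_cols cols_def[symmetric] largest_part_eq_conjugate
  by (simp add: not_in_iff)

lemma crank_ge_iff:
  assumes "\<pi> \<in> partitions n"
  shows "crank \<pi> \<ge> int (j + 1) \<longleftrightarrow> (if ones (cols \<pi>) = 0 then 0 < cols \<pi> j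
    else ones (cols \<pi>) + j < cols \<pi> (ones (cols \<pi>)))"
proof -
  have "cols \<pi> \<in> ferrers n" using cols_ferrers[of \<pi>] assms by (simp add: partitions_def)
  then have "j < conjugate (cols \<pi>) 0 \<longleftrightarrow> 0 < cols \<pi> j" by (rule less_conjugate_iff)
  then show ?thesis unfolding crank_eq by auto
qed

text \<open>With \<open>a \<ge> 1\<close> ones, crank at least \<open>i + 1\<close> reads
  \<open>a + i < f a\<close>, and swapping index and height gives \<open>a < f (a + i)\<close>. For
  \<open>a = 0\<close> the condition on the largest part already has this form.\<close>

lemma card_partitions_crank_ge:
  assumes "j \<ge> 1" "n \<noteq> 1"
  shows "card {\<pi> \<in> partitions n. crank \<pi> \<ge> int j} = pbar 1 j n"
proof -
  obtain i where j: "j = i + 1" using assms(1) by (metis le_add_diff_inverse2)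
  define P where "P f \<longleftrightarrow> (if ones f = 0 then 0 < f i else ones f + i < f (ones f))" for f
  have "card {\<pi> \<in> partitions n. crank \<pi> \<ge> int j} = card {\<pi> \<in> partitions n. P (cols \<pi>)}"
    unfolding j P_def by (intro arg_cong[where f = card] Collect_cong conj_cong refl crank_ge_iff)
  also have "\<dots> = card {f \<in> ferrers n. P f}" by (rule card_partitions_cols)
  also have "\<dots> = (\<Sum>a\<le>n. card {f \<in> ferrers n. ones f = a \<and> P f})" by (rule card_split_ones)
  also have "\<dots> = (\<Sum>a\<le>n. card {f \<in> ferrers n. ones f = a \<and> ones f < f (ones f + i)})"
  proof (intro sum.cong refl)
    fix a
    show "card {f \<in> ferrers n. ones f = a \<and> P f} = card {f \<in> ferrers n. ones f = a \<and> ones f < f (ones f + i)}"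
    proof (cases "a = 0")
      case True
      then show ?thesis unfolding P_def by (intro arg_cong[where f = card] Collect_cong) auto
    next
      case False
      have "card {f \<in> ferrers n. ones f = a \<and> P f} = card {f \<in> ferrers n. ones f = a \<and> a + i < f a}"
        unfolding P_def using False by (intro arg_cong[where f = card] Collect_cong) auto
      also have "\<dots> = card {f \<in> ferrers n. ones f = a \<and> a < f (a + i)}"
        using False by (intro card_ones_eq_swap) auto
      also have "\<dots> = card {f \<in> ferrers n. ones f = a \<and> ones f < f (ones f + i)}"
        by (intro arg_cong[where f = card] Collect_cong) auto
      finally show ?thesis .
    qed
  qed
  also have "\<dots> = card {f \<in> ferrers n. ones f < f (ones f + i)}" by (rule card_split_ones[symmetric])
  also have "\<dots> = pbar 1 j n" unfolding j using assms(2) by (intro card_ones_less) simp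
  finally show ?thesis .
qed

text \<open>A negative crank forces ones to be present. The first conjunct prepares the deletion of
  \<open>j\<close> ones by \<open>card_add_ones\<close>.\<close>

lemma crank_le_iff:
  assumes "j \<ge> 1"
  shows "crank \<pi> \<le> - int j \<longleftrightarrow> j \<le> ones (cols \<pi>) \<and> cols \<pi> (ones (cols \<pi>)) + j \<le> ones (cols \<pi>)"
  unfolding crank_eq using assms by auto

text \<open>Deleting \<open>j\<close> ones turns the condition into the negation of the one in
  \<open>card_ones_less\<close> with excess \<open>j\<close>. As \<open>j \<ge> 1\<close>, the
  exceptional pair is avoided and \<open>n = 1\<close> is covered.\<close>

lemma card_partitions_crank_le:
  assumes j: "j \<ge> 1"
  shows "card {\<pi> \<in> partitions n. crank \<pi> \<le> - int j} = pbar 1 j n"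
proof -
  have "card {\<pi> \<in> partitions n. crank \<pi> \<le> - int j}
      = card {\<pi> \<in> partitions n. j \<le> ones (cols \<pi>) \<and> cols \<pi> (ones (cols \<pi>)) + j \<le> ones (cols \<pi>)}"
    by (intro arg_cong[where f = card] Collect_cong conj_cong refl crank_le_iff j)
  also have "\<dots> = card {f \<in> ferrers n. j \<le> ones f \<and> f (ones f) + j \<le> ones f}"
    by (rule card_partitions_cols)
  also have "\<dots> = pbar 1 j n"
  proof (cases "j \<le> n")
    case True
    then obtain m where n: "n = m + j" by (metis le_add_diff_inverse2)
    define shift where "shift f = f(0 := f 0 + j)" for f :: "nat \<Rightarrow> nat"
    have "card {f \<in> ferrers n. j \<le> ones f \<and> f (ones f) + j \<le> ones f}
        = card {f \<in> ferrers m. shift f (ones (shift f)) + j \<le> ones (shift f)}"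
      unfolding n shift_def by (rule card_add_ones)
    also have "\<dots> = card {f \<in> ferrers m. \<not> ones f < f (ones f + j)}"
    proof (intro arg_cong[where f = card] Collect_cong conj_cong refl)
      fix f assume f: "f \<in> ferrers m"
      have "ones (shift f) = ones f + j"
        using ferrers_antimono[OF f, of 0 1] by (simp add: shift_def ones_def)
      then show "shift f (ones (shift f)) + j \<le> ones (shift f) \<longleftrightarrow> \<not> ones f < f (ones f + j)"
        using j by (simp add: shift_def not_less)
    qed
    finally have "card {f \<in> ferrers n. j \<le> ones f \<and> f (ones f) + j \<le> ones f} + pbar 1 (j + 1) m
        = card (ferrers m)"
      using card_filter_not[OF finite_ferrers, of m "\<lambda>f. ones f < f (ones f + j)"]
        card_ones_less[of m j] j by simp
    moreover have "pbar 1 j n + pbar 1 (j + 1) m = card (ferrers m)"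
      using pbar_rec[of 1 j m] j unfolding n card_partitions by simp
    ultimately show ?thesis by linarith
  next
    case False
    have "\<not> j \<le> ones f" if f: "f \<in> ferrers n" for f
      using ferrers_le[OF f, of 0] False by (simp add: ones_def)
    then have "{f \<in> ferrers n. j \<le> ones f \<and> f (ones f) + j \<le> ones f} = {}" by blast
    then show ?thesis using False by (simp add: pbar_eq_0)
  qed
  finally show ?thesis .
qed

lemma abs_rank_le:
  assumes "\<pi> \<in> partitions n"
  shows "\<bar>rank \<pi>\<bar> \<le> int n"
proof -
  have f: "cols \<pi> \<in> ferrers n" using cols_ferrers[of \<pi>] assms by (simp add: partitions_def)
  show ?thesis using rank_eq[OF assms] conjugate_0_le[OF f] ferrers_le[OF f, of 0] by linarith
qed

lemma abs_crank_le:
  assumes "\<pi> \<in> partitions n"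
  shows "\<bar>crank \<pi>\<bar> \<le> int n"
proof -
  have f: "cols \<pi> \<in> ferrers n" using cols_ferrers[of \<pi>] assms by (simp add: partitions_def)
  have "ones (cols \<pi>) \<le> n" using ferrers_le[OF f, of 0] by (simp add: ones_def)
  then show ?thesis
    using crank_eq[of \<pi>] conjugate_0_le[OF f] ferrers_le[OF f, of "ones (cols \<pi>)"] by (simp split: if_splits)
qed

subsection \<open>Second moments\<close>

lemma Sum_any_square_fibres:
  fixes \<rho> :: "'a \<Rightarrow> int"
  assumes "finite S"
  shows "Sum_any (\<lambda>m. m\<^sup>2 * int (card {x \<in> S. \<rho> x = m})) = (\<Sum>x\<in>S. (\<rho> x)\<^sup>2)"
proof -
  have "Sum_any (\<lambda>m. m\<^sup>2 * int (card {x \<in> S. \<rho> x = m})) = (\<Sum>m\<in>\<rho> ` S. m\<^sup>2 * int (card {x \<in> S. \<rho> x = m}))"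
  proof (rule Sum_any.expand_superset)
    show "{m. m\<^sup>2 * int (card {x \<in> S. \<rho> x = m}) \<noteq> 0} \<subseteq> \<rho> ` S"
    proof
      fix m assume "m \<in> {m. m\<^sup>2 * int (card {x \<in> S. \<rho> x = m}) \<noteq> 0}"
      then have "{x \<in> S. \<rho> x = m} \<noteq> {}" by fastforce
      then show "m \<in> \<rho> ` S" by blast
    qed
  qed (use assms in simp)
  also have "\<dots> = (\<Sum>m\<in>\<rho> ` S. \<Sum>x\<in>{x \<in> S. \<rho> x = m}. (\<rho> x)\<^sup>2)"
    by (intro sum.cong refl) simp
  also have "\<dots> = (\<Sum>x\<in>S. (\<rho> x)\<^sup>2)" by (rule sum.image_gen[OF assms, symmetric])
  finally show ?thesis .
qed

text \<open>The summands with \<open>r < \<bar>x\<bar>\<close> contribute one odd number each, and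
  consecutive odd numbers from \<open>1\<close> add up to a square.\<close>

lemma square_eq_sum_indicators:
  fixes x :: int
  assumes "\<bar>x\<bar> \<le> int n"
  shows "x\<^sup>2 = (\<Sum>r<n. (2 * int r + 1) * (of_bool (x \<ge> int (r + 1)) + of_bool (x \<le> - int (r + 1))))"
proof -
  define t where "t = nat \<bar>x\<bar>"
  have "(\<Sum>r<n. (2 * int r + 1) * (of_bool (x \<ge> int (r + 1)) + of_bool (x \<le> - int (r + 1))))
      = (\<Sum>r<n. if r < t then 2 * int r + 1 else 0)"
    by (intro sum.cong refl) (auto simp: t_def)
  also have "\<dots> = (\<Sum>r<t. 2 * int r + 1)"
    using assms by (intro sum.mono_neutral_cong_right) (auto simp: t_def)
  also have "\<dots> = (int t)\<^sup>2" by (induction t) (auto simp: power2_eq_square algebra_simps)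
  also have "\<dots> = x\<^sup>2" by (simp add: t_def)
  finally show ?thesis by simp
qed

text \<open>Shared by rank and crank: interchanging the sums turns the indicators into the two tail
  counts, both equal to \<open>P (r + 1)\<close>.\<close>

lemma sum_square_eq:
  fixes \<rho> :: "'a \<Rightarrow> int"
  assumes "finite S" "\<And>x. x \<in> S \<Longrightarrow> \<bar>\<rho> x\<bar> \<le> int n"
    and ge: "\<And>j. j \<ge> 1 \<Longrightarrow> card {x \<in> S. \<rho> x \<ge> int j} = P j"
    and le: "\<And>j. j \<ge> 1 \<Longrightarrow> card {x \<in> S. \<rho> x \<le> - int j} = P j"
  shows "(\<Sum>x\<in>S. (\<rho> x)\<^sup>2) = 2 * (\<Sum>r<n. (2 * int r + 1) * int (P (r + 1)))"
proof -
  have card: "(\<Sum>x\<in>S. of_bool (Q x)) = int (card {x \<in> S. Q x})" for Q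
    using assms(1) by (simp add: of_bool_def sum.If_cases Int_def)
  have "(\<Sum>x\<in>S. (\<rho> x)\<^sup>2) = (\<Sum>x\<in>S. \<Sum>r<n. (2 * int r + 1) *
      (of_bool (\<rho> x \<ge> int (r + 1)) + of_bool (\<rho> x \<le> - int (r + 1))))"
    using assms(2) by (intro sum.cong refl square_eq_sum_indicators)
  also have "\<dots> = (\<Sum>r<n. \<Sum>x\<in>S. (2 * int r + 1) *
      (of_bool (\<rho> x \<ge> int (r + 1)) + of_bool (\<rho> x \<le> - int (r + 1))))" by (rule sum.swap)
  also have "\<dots> = (\<Sum>r<n. (2 * int r + 1) * (2 * int (P (r + 1))))"
  proof (intro sum.cong refl)
    fix r
    have "(\<Sum>x\<in>S. (2 * int r + 1) * (of_bool (\<rho> x \<ge> int (r + 1)) + of_bool (\<rho> x \<le> - int (r + 1))))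
      = (2 * int r + 1) * (int (card {x \<in> S. \<rho> x \<ge> int (r + 1)}) + int (card {x \<in> S. \<rho> x \<le> - int (r + 1)}))"
      unfolding sum_distrib_left[symmetric] sum.distrib card ..
    then show "(\<Sum>x\<in>S. (2 * int r + 1) * (of_bool (\<rho> x \<ge> int (r + 1)) + of_bool (\<rho> x \<le> - int (r + 1))))
      = (2 * int r + 1) * (2 * int (P (r + 1)))"
      unfolding ge[of "r + 1", simplified le_add2] using ge[of "r + 1"] le[of "r + 1"] by simp
  qed
  finally show ?thesis by (simp add: sum_distrib_left mult.left_commute)
qed

theorem theorem3p8:
  fixes n :: nat
  assumes "n \<ge> 1"
  shows "rank_moment2 n = 2 * (\<Sum>r<n - 1. (2 * int r + 1) * int (pbar 3 (r + 2) n)) \<and>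
         crank_moment2 n = 2 * (\<Sum>r<n. (2 * int r + 1) * int (pbar 1 (r + 1) n))"
proof
  have "rank_moment2 n = (\<Sum>\<pi>\<in>partitions n. (rank \<pi>)\<^sup>2)"
    unfolding rank_moment2_def rank_count_def by (rule Sum_any_square_fibres) simp
  also have "\<dots> = 2 * (\<Sum>r<n. (2 * int r + 1) * int (pbar 3 (r + 1 + 1) n))"
    by (rule sum_square_eq) (simp_all only: finite_partitions abs_rank_le card_partitions_rank_ge card_partitions_rank_le)
  \<comment> \<open>The term \<open>r = n - 1\<close> vanishes, as its run would start at
    \<open>n + 1\<close>.\<close>
  also have "(\<Sum>r<n. (2 * int r + 1) * int (pbar 3 (r + 1 + 1) n))
      = (\<Sum>r<n - 1. (2 * int r + 1) * int (pbar 3 (r + 2) n))"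
    using assms by (cases n) (simp_all add: pbar_eq_0)
  finally show "rank_moment2 n = 2 * (\<Sum>r<n - 1. (2 * int r + 1) * int (pbar 3 (r + 2) n))" .
next
  show "crank_moment2 n = 2 * (\<Sum>r<n. (2 * int r + 1) * int (pbar 1 (r + 1) n))"
  proof (cases "n = 1")
    case False
    then have "crank_moment2 n = (\<Sum>\<pi>\<in>partitions n. (crank \<pi>)\<^sup>2)"
      unfolding crank_moment2_def crank_count_def
      by (simp only: if_False) (rule Sum_any_square_fibres, simp)
    also have "\<dots> = 2 * (\<Sum>r<n. (2 * int r + 1) * int (pbar 1 (r + 1) n))"
      by (rule sum_square_eq) (simp_all only: finite_partitions abs_crank_le card_partitions_crank_ge card_partitions_crank_le False not_False_eq_True)
    finally show ?thesis .
  next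
    case True
    \<comment> \<open>The only partition of \<open>1\<close> has crank \<open>-1\<close>, but the
      convention replaces its count, so the moment is computed from the conventional values.\<close>
    have "crank_moment2 1 = (\<Sum>m\<in>{1, - 1 :: int}. m\<^sup>2 * crank_count m 1)"
      unfolding crank_moment2_def
      by (rule Sum_any.expand_superset) (auto simp: crank_count_def split: if_splits)
    also have "\<dots> = 2" by (simp add: crank_count_def)
    finally have "crank_moment2 1 = 2" .
    moreover have "partitions 0 = {{#}}"
    proof -
      have "\<pi> = {#}" if "\<pi> \<in> partitions 0" for \<pi>
        using that by (cases \<pi>) (auto simp: partitions_def)
      then show ?thesis by (auto simp: partitions_def)
    qed
    then have "pbar 1 1 1 = 1"
      using pbar_rec[of 1 1 0] pbar_eq_0[of 1 0 2] by (simp add: numeral_2_eq_2)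
    ultimately show ?thesis using True by simp
  qed
qed

end
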